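(* Let $j\in\mathbb{Z}$, let $x>0$, and let $q$ be a positive integer. For each function $f\in E$ for which the derivative $f^{(2q)}(x)$ exists, the operators $S_{n,j}$ possess the asymptotic expansion $$\left(S_{n,j}f\right)(x)=f(x)+\sum_{k=1}^{q}\frac{1}{k!\,n^{k}}\left(\mathcal{D}_{j}^{2k}f\right)(x)+o\left(n^{-q}\right)\qquad (n\rightarrow\infty).$$
   Context: For $A\ge 0$, $E_A$ denotes the space of locally integrable functions $f:[0,\infty)\to\mathbb{R}$ satisfying $|f(t)|\le Ke^{At}$ for all $t\ge 0$, for some constant $K>0$; and $E:=\bigcup_{A\ge 0}E_A$. Put $s_{n,k}(x)=\frac{(nx)^k}{k!}e^{-nx}$ for integers $k\ge 0$ and $s_{n,k}(x)=0$ for $k<0$. For $j\in\mathbb{Z}$, $f\in E_A$ and positive integers $n>A$, the operator $S_{n,j}$ is defined for $x\ge0$ by $$(S_{n,j}f)(x)=f(0)\sum_{k=0}^{j-1}s_{n,k}(x)+\sum_{k=j}^{\infty}s_{n,k}(x)\,n\int_0^\infty s_{n,k-j}(t)f(t)\,dt.$$ A sum is zero if its upper limit is smaller than its lower limit. The differential operator $\mathcal{D}_j^{2k}$ for $k\in\mathbb{N}=\{1,2,\dots\}$ is $\mathcal{D}_j^{2k}=e_jD^k(e_{k-j}D^k)$, where $D$ is ordinary differentiation and $e_\ell(t)=t^\ell$ (also for negative integers $\ell$, at $t>0$); that is, $$(\mathcal{D}_j^{2k}f)(x)=x^j\left(x^{k-j}f^{(k)}(x)\right)^{(k)}.$$ For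 a positive integer $r$, existence of $f^{(r)}(x)$ means that $f$ is $(r-1)$ times differentiable near $x$ and $f^{(r-1)}$ is differentiable at $x$. *)

theory Defs
  imports "HOL-Analysis.Analysis" "HOL-Library.Landau_Symbols"
begin

text \<open>Functions on \<open>[0,\<infinity>)\<close> are represented by total functions; values at negative arguments are
  irrelevant. Locally integrable means Lebesgue integrable on each compact interval
  \<open>[0,b]\<close>.\<close>

definition E_exp :: "real \<Rightarrow> (real \<Rightarrow> real) set" where
  "E_exp A = {f. (\<forall>b\<ge>0. set_integrable lebesgue {0..b} f) \<and>
                 (\<exists>K>0. \<forall>t\<ge>0. \<bar>f t\<bar> \<le> K * exp (A * t))}"

definition E_space :: "(real \<Rightarrow> real) set" where
  "E_space = (\<Union>A\<in>{0..}. E_exp A)"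

definition szasz_basis :: "nat \<Rightarrow> int \<Rightarrow> real \<Rightarrow> real" where
  "szasz_basis n k x =
     (if k < 0 then 0 else (real n * x) ^ nat k / fact (nat k) * exp (- (real n * x)))"

text \<open>For \<open>f \<in> E_exp A\<close>, \<open>n > A\<close> and \<open>x \<ge> 0\<close> the integrals below exist and the series converges
  absolutely. For other \<open>n\<close> the value is unspecified and plays no role as \<open>n \<rightarrow> \<infinity>\<close>.\<close>

definition szasz_durrmeyer :: "nat \<Rightarrow> int \<Rightarrow> (real \<Rightarrow> real) \<Rightarrow> real \<Rightarrow> real" where
  "szasz_durrmeyer n j f x =
     f 0 * (\<Sum>k\<in>{0..j - 1}. szasz_basis n k x) +
     (\<Sum>\<^sub>\<infinity>k\<in>{j..}. szasz_basis n k x *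
        (real n * (LINT t:{0..}|lebesgue. szasz_basis n (k - j) t * f t)))"

text \<open>Existence of the \<open>r\<close>-th derivative at the point \<open>x\<close> (intended for \<open>r \<ge> 1\<close>): \<open>f\<close> is \<open>r - 1\<close>
  times differentiable on a neighbourhood of \<open>x\<close>, and its \<open>(r - 1)\<close>-st derivative is
  differentiable at \<open>x\<close> itself.\<close>

definition has_nth_deriv_at :: "(real \<Rightarrow> real) \<Rightarrow> nat \<Rightarrow> real \<Rightarrow> bool" where
  "has_nth_deriv_at f r x \<longleftrightarrow>
     (\<forall>\<^sub>F y in nhds x. \<forall>i < r - 1. (deriv ^^ i) f differentiable (at y)) \<and>
     (deriv ^^ (r - 1)) f differentiable (at x)"

text \<open>Because of the possibly negative exponents, this is meaningful only for \<open>x > 0\<close>.\<close>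

definition diff_op :: "int \<Rightarrow> nat \<Rightarrow> (real \<Rightarrow> real) \<Rightarrow> real \<Rightarrow> real" where
  "diff_op j k f x =
     x powi j * (deriv ^^ k) (\<lambda>t. t powi (int k - j) * (deriv ^^ k) f t) x"

end

theory Submission
  imports Defs "HOL-Probability.Distributions"
begin

text \<open>
  The expansion is exact on monomials up to exponentially small terms, and the general case follows by
  Taylor approximation and localisation.

  The function \<open>n s\<^bsub>n,l\<^esub>\<close> is the gamma density with shape \<open>l + 1\<close> and rate \<open>n\<close>, and the numbers
  \<open>s\<^bsub>n,k\<^esub>(x)\<close> are Poisson weights with mean \<open>n x\<close>. So the image of \<open>t\<^sup>N\<close> is a Poisson sum of gamma moments,
  which are the rising factorials \<open>(k - j + 1) \<cdots> (k - j + N) / n\<^sup>N\<close>. Written as binomial coefficients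
  with upper entry \<open>k + (N - j)\<close> they split by the Chu--Vandermonde identity into factorial moments of
  the Poisson distribution. The result is
  \<open>\<Sum>\<^sub>i (N! / (N - i)!) ((N - j) choose i) x\<^bsup>N-i\<^esup> / n\<^sup>i\<close> (\<open>szasz_basis_rising_moment_has_sum\<close>), and a second
  use of Chu--Vandermonde, after the Leibniz rule, identifies the coefficient of \<open>n\<^bsup>-i\<^esup>\<close> as \<open>1 / i!\<close> times
  the value of \<open>\<D>\<^sub>j\<^bsup>2i\<^esup>\<close> at \<open>t\<^sup>N\<close> (\<open>jet_op_monom\<close>). For \<open>j > 0\<close> the finitely many terms with \<open>k < j\<close> are
  missing from the series, and \<open>f(0)\<close> replaces them; both effects decay like a power of \<open>n\<close> times
  \<open>e\<^bsup>-nx\<^esup>\<close>. By linearity the expansion holds for every polynomial, with an error \<open>O(n\<^bsup>-q-1\<^esup>)\<close>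
  (\<open>has_expansion_poly\<close>).

  Since \<open>\<D>\<^sub>j\<^bsup>2k\<^esup>\<close> at \<open>x\<close> involves derivatives of order at most \<open>2 k\<close>, it vanishes on \<open>(t - x)\<^bsup>2q\<^esup>\<close> for
  \<open>k < q\<close>, and the central moment of order \<open>2 q\<close> is \<open>O(n\<^bsup>-q\<^esup>)\<close> (\<open>szasz_tail_central_moment_bigo\<close>). Now
  \<open>f\<close> is its Taylor polynomial of degree \<open>2 q\<close> at \<open>x\<close> plus a remainder \<open>g\<close> that is
  \<open>o((t - x)\<^bsup>2q\<^esup>)\<close> near \<open>x\<close> and of exponential growth. The polynomial has the same derivatives as \<open>f\<close> at
  \<open>x\<close> up to the order \<open>2 q\<close>, hence it gives the main terms (\<open>diff_op_eq_jet_op\<close>). By positivity the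
  remainder contributes \<open>o(n\<^bsup>-q\<^esup>)\<close> (\<open>szasz_tail_smallo\<close>): near \<open>x\<close> it is a small multiple of
  \<open>(t - x)\<^bsup>2q\<^esup>\<close>, and away from \<open>x\<close> it is dominated by
  \<open>n\<^bsup>q+1\<^esup> (t - x)\<^bsup>4q+4\<^esup> + n\<^bsup>-q-1\<^esup> e\<^bsup>2Bt\<^esup>\<close> up to a constant factor.
\<close>

section \<open>Functions of exponential growth\<close>

lemma E_exp_mono: "A \<le> B \<Longrightarrow> E_exp A \<subseteq> E_exp B"
proof
  fix f assume AB: "A \<le> B" and "f \<in> E_exp A"
  then obtain K where K: "K > 0" "\<And>t. t \<ge> 0 \<Longrightarrow> \<bar>f t\<bar> \<le> K * exp (A * t)"
    "\<forall>b\<ge>0. set_integrable lebesgue {0..b} f"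
    by (auto simp: E_exp_def)
  have "\<bar>f t\<bar> \<le> K * exp (B * t)" if "t \<ge> 0" for t
  proof -
    have "K * exp (A * t) \<le> K * exp (B * t)"
      using K AB that by (intro mult_left_mono) (auto intro: mult_right_mono)
    with K(2)[OF that] show ?thesis by simp
  qed
  with K show "f \<in> E_exp B" by (auto simp: E_exp_def)
qed

lemma E_exp_add:
  assumes "f \<in> E_exp A" "g \<in> E_exp A"
  shows "(\<lambda>t. f t + g t) \<in> E_exp A"
proof -
  obtain K L where K: "K > 0" "\<And>t. t \<ge> 0 \<Longrightarrow> \<bar>f t\<bar> \<le> K * exp (A * t)"
    and L: "L > 0" "\<And>t. t \<ge> 0 \<Longrightarrow> \<bar>g t\<bar> \<le> L * exp (A * t)"
    using assms by (auto simp: E_exp_def)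
  have "\<bar>f t + g t\<bar> \<le> (K + L) * exp (A * t)" if "t \<ge> 0" for t
    using K(2)[OF that] L(2)[OF that] by (simp add: algebra_simps)
  moreover have "K + L > 0" using K L by simp
  ultimately show ?thesis using assms
    by (auto simp: E_exp_def intro!: exI[of _ "K + L"])
qed

lemma E_exp_cmult:
  assumes "f \<in> E_exp A"
  shows "(\<lambda>t. c * f t) \<in> E_exp A"
proof -
  obtain K where K: "K > 0" "\<And>t. t \<ge> 0 \<Longrightarrow> \<bar>f t\<bar> \<le> K * exp (A * t)"
    using assms by (auto simp: E_exp_def)
  have "\<bar>c * f t\<bar> \<le> ((\<bar>c\<bar> + 1) * K) * exp (A * t)" if "t \<ge> 0" for t
  proof -
    have "\<bar>c\<bar> * \<bar>f t\<bar> \<le> (\<bar>c\<bar> + 1) * (K * exp (A * t))"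
      using K(2)[OF that] by (intro mult_mono) auto
    then show ?thesis by (simp add: abs_mult)
  qed
  moreover have "(\<bar>c\<bar> + 1) * K > 0" using K by simp
  ultimately show ?thesis using assms unfolding E_exp_def by blast
qed

lemma exp_in_E_exp: "(\<lambda>t. exp (A * t)) \<in> E_exp A"
proof -
  have "set_integrable lebesgue {0..b} (\<lambda>t. exp (A * t))" for b :: real
    by (intro absolutely_integrable_continuous_real continuous_intros)
  then show ?thesis by (auto simp: E_exp_def intro!: exI[of _ 1])
qed

text \<open>The bound is one term of the exponential series, \<open>t ^ m / m! \<le> e\<^sup>t\<close>.\<close>

lemma power_in_E_exp: "(\<lambda>t. t ^ m) \<in> E_exp 1"
proof -
  have "set_integrable lebesgue {0..b} (\<lambda>t. t ^ m)" for b :: real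
    by (intro absolutely_integrable_continuous_real continuous_intros)
  moreover have "\<bar>t ^ m\<bar> \<le> fact m * exp (1 * t)" if "t \<ge> 0" for t :: real
  proof -
    have "(\<Sum>i\<in>{m}. t ^ i /\<^sub>R fact i) \<le> exp t"
      unfolding exp_def using that by (intro sum_le_suminf summable_exp_generic) auto
    then show ?thesis using that by (simp add: field_simps)
  qed
  ultimately show ?thesis by (auto simp: E_exp_def intro!: exI[of _ "fact m"])
qed

lemma poly_in_E_exp: "poly p \<in> E_exp 1"
proof -
  have "(\<lambda>t. \<Sum>i\<in>I. coeff p i * t ^ i) \<in> E_exp 1" if "finite I" for I
    using that
  proof induction
    case empty
    show ?case using E_exp_cmult[OF exp_in_E_exp, of 0 1] by simp
  next
    case (insert i I)
    then show ?case using E_exp_add[OF E_exp_cmult[OF power_in_E_exp]] by simp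
  qed
  then show ?thesis by (simp add: poly_altdef[abs_def])
qed

text \<open>Integrability is assumed only on compact intervals, so measurability on the half line is
  obtained as a pointwise limit of truncations.\<close>

lemma E_exp_indicator_measurable:
  assumes "f \<in> E_exp A"
  shows "(\<lambda>t. indicator {0..} t * f t) \<in> borel_measurable lebesgue"
proof (rule borel_measurable_LIMSEQ_real)
  show "(\<lambda>b. indicator {0..real b} t * f t) \<longlonglongrightarrow> indicator {0..} t * f t" for t
  proof -
    have "\<forall>\<^sub>F b in sequentially. indicator {0..real b} t * f t = indicator {0..} t * f t"
      using eventually_ge_at_top[of "nat \<lceil>t\<rceil>"]
      by eventually_elim (auto simp: indicator_def; linarith)
    then show ?thesis by (rule tendsto_eventually)
  qed
  show "(\<lambda>t. indicator {0..real b} t * f t) \<in> borel_measurable lebesgue" for b :: nat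
    using assms by (auto simp: E_exp_def set_integrable_def dest!: spec[of _ "real b"])
qed

lemma central_power_in_E_exp: "(\<lambda>t. (t - x) ^ m) \<in> E_exp 1"
  using poly_in_E_exp[of "[:- x, 1:] ^ m"] by (simp add: poly_power[abs_def])

section \<open>Means under gamma densities\<close>

text \<open>The normalised basis function \<open>n s\<^bsub>n,l\<^esub>\<close> is the density of the gamma distribution with shape
  \<open>l + 1\<close> and rate \<open>n\<close>, so the inner integrals of the operator are expectations.\<close>

definition gamma_mean :: "nat \<Rightarrow> nat \<Rightarrow> (real \<Rightarrow> real) \<Rightarrow> real" where
  "gamma_mean n l f = (LINT t|lebesgue. erlang_density l (real n) t * f t)"

lemma szasz_integral_eq_gamma_mean:
  assumes "n > 0"
  shows "real n * (LINT t:{0..}|lebesgue. szasz_basis n (int l) t * f t) = gamma_mean n l f"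
proof -
  have "real n * (indicator {0..} t *\<^sub>R (szasz_basis n (int l) t * f t)) = erlang_density l (real n) t * f t" for t
    by (auto simp: szasz_basis_def erlang_density_def power_mult_distrib indicator_def)
  then show ?thesis
    unfolding gamma_mean_def set_lebesgue_integral_def
    by (simp only: flip: integral_mult_right_zero)
qed

text \<open>Exponential tilting turns a gamma density into a multiple of one with a smaller rate. This
  gives integrability of the functions of exponential type \<open>A < n\<close> and the exact value of the mean of
  \<open>exp (A t)\<close>.\<close>

lemma erlang_density_times_exp:
  assumes "real n > A"
  shows "erlang_density l (real n) t * exp (A * t) =
    (real n / (real n - A)) ^ Suc l * erlang_density l (real n - A) t"
proof -
  have "exp (- real n * t) * exp (A * t) = exp (- (real n - A) * t)"
    by (simp add: algebra_simps flip: exp_add)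
  then show ?thesis
    using assms by (simp add: erlang_density_def power_divide mult.assoc del: power_Suc)
qed

lemma erlang_ith_moment:
  assumes "c > 0"
  shows "has_bochner_integral lebesgue (\<lambda>t. erlang_density l c t * t ^ m)
           (fact (l + m) / (fact l * c ^ m))"
proof -
  have 0: "0 \<le> erlang_density l c t * t ^ m" for t
    using assms by (cases "t < 0") (auto simp: erlang_density_def)
  have "has_bochner_integral lborel (\<lambda>t. erlang_density l c t * t ^ m)
           (fact (l + m) / (fact l * c ^ m))"
    using assms 0 by (intro has_bochner_integral_nn_integral)
      (auto simp: nn_integral_erlang_ith_moment)
  then show ?thesis
    by (simp add: has_bochner_integral_iff integral_completion integrable_completion)
qed

lemma gamma_mean_integrable:
  assumes "f \<in> E_exp A" "real n > A" "A \<ge> 0"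
  shows "integrable lebesgue (\<lambda>t. erlang_density l (real n) t * f t)"
proof -
  obtain K where K: "K > 0" "\<And>t. t \<ge> 0 \<Longrightarrow> \<bar>f t\<bar> \<le> K * exp (A * t)"
    using assms by (auto simp: E_exp_def)
  have eq: "(\<lambda>t. erlang_density l (real n) t * f t) =
      (\<lambda>t. erlang_density l (real n) t * (indicator {0..} t * f t))"
    by (auto simp: erlang_density_def indicator_def)
  have "erlang_density l (real n) \<in> borel_measurable lebesgue"
    by (rule measurable_completion) simp
  then have m: "(\<lambda>t. erlang_density l (real n) t * f t) \<in> borel_measurable lebesgue"
    unfolding eq using E_exp_indicator_measurable[OF assms(1)] by measurable
  have "integrable lebesgue (\<lambda>t. K * ((real n / (real n - A)) ^ Suc l * erlang_density l (real n - A) t))"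
    using erlang_ith_moment[of "real n - A" l 0] assms
    by (intro integrable_mult_right) (auto simp: has_bochner_integral_iff)
  then show ?thesis
  proof (rule Bochner_Integration.integrable_bound[OF _ m], intro AE_I2)
    fix t
    show "norm (erlang_density l (real n) t * f t)
       \<le> norm (K * ((real n / (real n - A)) ^ Suc l * erlang_density l (real n - A) t))"
    proof (cases "t < 0")
      case False
      then have "erlang_density l (real n) t * \<bar>f t\<bar> \<le> erlang_density l (real n) t * (K * exp (A * t))"
        using K(2)[of t] by (intro mult_left_mono) auto
      then show ?thesis using K(1) assms
        unfolding erlang_density_times_exp[OF assms(2), symmetric]
        by (simp add: abs_mult mult_ac)
    qed (simp add: erlang_density_def)
  qed
qed

lemma gamma_mean_add:
  assumes "f \<in> E_exp A" "g \<in> E_exp A" "real n > A" "A \<ge> 0"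
  shows "gamma_mean n l (\<lambda>t. f t + g t) = gamma_mean n l f + gamma_mean n l g"
  using assms by (simp add: gamma_mean_def ring_distribs gamma_mean_integrable)

lemma gamma_mean_cmult: "gamma_mean n l (\<lambda>t. c * f t) = c * gamma_mean n l f"
  by (simp add: gamma_mean_def mult.left_commute[of _ c])

lemma gamma_mean_mono:
  assumes "f \<in> E_exp A" "g \<in> E_exp A" "real n > A" "A \<ge> 0"
    and "\<And>t. t \<ge> 0 \<Longrightarrow> f t \<le> g t"
  shows "gamma_mean n l f \<le> gamma_mean n l g"
  unfolding gamma_mean_def
proof (intro integral_mono gamma_mean_integrable)
  fix t
  show "erlang_density l (real n) t * f t \<le> erlang_density l (real n) t * g t"
  proof (cases "t < 0")
    case False
    then show ?thesis using assms(5)[of t] by (intro mult_left_mono) auto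
  qed (simp add: erlang_density_def)
qed (use assms in auto)

lemma gamma_mean_power:
  assumes "n > 0"
  shows "gamma_mean n l (\<lambda>t. t ^ m) = fact (l + m) / (fact l * real n ^ m)"
  using erlang_ith_moment[of "real n" l m] assms
  by (simp add: gamma_mean_def has_bochner_integral_iff)

lemma gamma_mean_exp:
  assumes "real n > A"
  shows "gamma_mean n l (\<lambda>t. exp (A * t)) = (real n / (real n - A)) ^ Suc l"
  using erlang_ith_moment[of "real n - A" l 0] assms
  by (simp add: gamma_mean_def erlang_density_times_exp has_bochner_integral_iff del: power_Suc)

section \<open>The operator as a positive linear functional\<close>

text \<open>The part of the operator without the value at \<open>0\<close>. On functions of exponential type \<open>A < n\<close>
  it is linear and monotone, so that estimates of functions carry over to their images.\<close>

definition szasz_tail :: "nat \<Rightarrow> int \<Rightarrow> (real \<Rightarrow> real) \<Rightarrow> real \<Rightarrow> real" where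
  "szasz_tail n j f x = (\<Sum>\<^sub>\<infinity>k\<in>{j..}. szasz_basis n k x * gamma_mean n (nat (k - j)) f)"

lemma szasz_durrmeyer_eq_tail:
  assumes "n > 0"
  shows "szasz_durrmeyer n j f x = f 0 * (\<Sum>k\<in>{0..j - 1}. szasz_basis n k x) + szasz_tail n j f x"
proof -
  have "real n * (LINT t:{0..}|lebesgue. szasz_basis n (k - j) t * f t) = gamma_mean n (nat (k - j)) f"
    if "k \<in> {j..}" for k
    using szasz_integral_eq_gamma_mean[OF assms, of "nat (k - j)" f] that by simp
  then show ?thesis
    unfolding szasz_durrmeyer_def szasz_tail_def by (intro arg_cong2[where f = "(+)"] refl infsum_cong) simp
qed

lemma szasz_basis_nonneg: "x \<ge> 0 \<Longrightarrow> szasz_basis n k x \<ge> 0"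
  by (simp add: szasz_basis_def)

lemma exp_series_has_sum: "((\<lambda>i. y ^ i / fact i) has_sum exp y) UNIV" for y :: real
  using exp_converges[of y] summable_norm_exp[of y]
  by (intro norm_summable_imp_has_sum) (simp_all add: divide_inverse_commute)

text \<open>The generating function of the Poisson weights. The sum runs over all integers, because the
  index set of the operator starts at \<open>j\<close>, which may be negative; the added terms are zero.\<close>

lemma szasz_basis_generating_has_sum:
  "((\<lambda>k. szasz_basis n k x * \<rho> ^ nat k) has_sum exp (real n * x * (\<rho> - 1))) UNIV"
proof -
  have "((\<lambda>i. exp (- (real n * x)) * ((real n * x * \<rho>) ^ i / fact i)) has_sum
      exp (- (real n * x)) * exp (real n * x * \<rho>)) UNIV"
    by (intro has_sum_cmult_right exp_series_has_sum)
  also have "exp (- (real n * x)) * exp (real n * x * \<rho>) = exp (real n * x * (\<rho> - 1))"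
    by (simp add: algebra_simps flip: exp_add)
  also have "(\<lambda>i. exp (- (real n * x)) * ((real n * x * \<rho>) ^ i / fact i)) =
      (\<lambda>k. szasz_basis n k x * \<rho> ^ nat k) \<circ> int"
    by (auto simp: szasz_basis_def power_mult_distrib)
  finally have "((\<lambda>k. szasz_basis n k x * \<rho> ^ nat k) has_sum exp (real n * x * (\<rho> - 1))) (range int)"
    using has_sum_reindex[OF inj_of_nat] by blast
  moreover have "szasz_basis n k x = 0" if "k \<notin> range int" for k
    using that zero_le_imp_eq_int[of k] by (auto simp: szasz_basis_def)
  ultimately show ?thesis
    by (subst has_sum_cong_neutral[where T = "range int"]) auto
qed

text \<open>The factorial moments of the Poisson distribution with mean \<open>n x\<close>, in divided form.\<close>

lemma szasz_basis_binomial_moment_has_sum: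
  "((\<lambda>k. szasz_basis n k x * (of_int k gchoose m)) has_sum (real n * x) ^ m / fact m) UNIV"
proof -
  let ?y = "real n * x"
  let ?g = "\<lambda>k. szasz_basis n k x * (of_int k gchoose m)"
  have "((\<lambda>i. ?y ^ m / fact m * exp (- ?y) * (?y ^ i / fact i)) has_sum
      ?y ^ m / fact m * exp (- ?y) * exp ?y) UNIV"
    by (intro has_sum_cmult_right exp_series_has_sum)
  also have "?y ^ m / fact m * exp (- ?y) * exp ?y = ?y ^ m / fact m"
    by (simp add: exp_minus)
  also have "(\<lambda>i. ?y ^ m / fact m * exp (- ?y) * (?y ^ i / fact i)) = ?g \<circ> (\<lambda>i. int (i + m))"
  proof
    fix i
    have "(real (i + m) gchoose m) = fact (i + m) / (fact m * fact i)"
      using binomial_fact[of m "i + m", where ?'a = real] by (simp only: binomial_gbinomial) simp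
    then show "?y ^ m / fact m * exp (- ?y) * (?y ^ i / fact i) = (?g \<circ> (\<lambda>i. int (i + m))) i"
      by (simp add: szasz_basis_def nat_add_distrib power_add)
  qed
  finally have "(?g \<circ> (\<lambda>i. int (i + m)) has_sum ?y ^ m / fact m) UNIV" .
  then have "(?g has_sum ?y ^ m / fact m) (range (\<lambda>i. int (i + m)))"
    using has_sum_reindex[of "\<lambda>i. int (i + m)" UNIV ?g] by (simp add: inj_on_def)
  moreover have "?g k = 0" if "k \<notin> range (\<lambda>i. int (i + m))" for k
  proof (cases "k < 0")
    case False
    have "k < int m"
    proof (rule ccontr)
      assume "\<not> k < int m"
      then have "k = int (nat (k - int m) + m)" by simp
      with that show False by blast
    qed
    with False have "(of_int k :: real) gchoose m = of_nat (nat k choose m)" "nat k < m"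
      by (simp_all add: binomial_gbinomial)
    then show ?thesis by (simp add: binomial_eq_0)
  qed (simp add: szasz_basis_def)
  ultimately show ?thesis
    by (subst has_sum_cong_neutral[where T = "range (\<lambda>i. int (i + m))"]) auto
qed

text \<open>The mean of \<open>exp (A t)\<close> grows geometrically in \<open>k\<close> with ratio \<open>n / (n - A)\<close>. The shift by \<open>j\<close> is
  absorbed into a constant factor, which leaves a term of the generating function.\<close>

lemma szasz_tail_exp_term_le:
  assumes "real n > A" "A \<ge> 0" "x \<ge> 0" "k \<ge> j"
  shows "szasz_basis n k x * (real n / (real n - A)) ^ Suc (nat (k - j))
     \<le> (real n / (real n - A)) ^ Suc (nat (- j)) *
        (szasz_basis n k x * (real n / (real n - A)) ^ nat k)"
proof (cases "k < 0")
  case False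
  let ?r = "real n / (real n - A)"
  have "?r \<ge> 1" using assms by simp
  moreover have "Suc (nat (k - j)) \<le> Suc (nat (- j)) + nat k" using False assms by linarith
  ultimately have "?r ^ Suc (nat (k - j)) \<le> ?r ^ (Suc (nat (- j)) + nat k)"
    by (rule power_increasing[rotated])
  then have "szasz_basis n k x * ?r ^ Suc (nat (k - j)) \<le> szasz_basis n k x * ?r ^ (Suc (nat (- j)) + nat k)"
    using szasz_basis_nonneg[OF assms(3)] by (intro mult_left_mono)
  then show ?thesis by (simp add: power_add mult_ac)
qed (simp add: szasz_basis_def)

text \<open>Each mean of \<open>f\<close> is bounded by the corresponding mean of \<open>K exp (A t)\<close>, so the generating
  function of the Poisson weights dominates the series.\<close>

lemma szasz_tail_summable:
  assumes f: "f \<in> E_exp A" and A: "real n > A" "A \<ge> 0" "x \<ge> 0"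
  shows "(\<lambda>k. szasz_basis n k x * gamma_mean n (nat (k - j)) f) summable_on {j..}"
proof -
  let ?r = "real n / (real n - A)"
  obtain K where K: "K > 0" "\<And>t. t \<ge> 0 \<Longrightarrow> \<bar>f t\<bar> \<le> K * exp (A * t)"
    using f by (auto simp: E_exp_def)
  have mean: "\<bar>gamma_mean n l f\<bar> \<le> K * ?r ^ Suc l" for l
  proof -
    have E: "(\<lambda>t. c * exp (A * t)) \<in> E_exp A" for c
      by (intro E_exp_cmult exp_in_E_exp)
    have "gamma_mean n l f \<le> gamma_mean n l (\<lambda>t. K * exp (A * t))"
      using K(2) by (intro gamma_mean_mono[OF f E A(1,2)]) fastforce
    moreover have "gamma_mean n l (\<lambda>t. (-K) * exp (A * t)) \<le> gamma_mean n l f"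
      using K(2) by (intro gamma_mean_mono[OF E f A(1,2)]) (fastforce simp: abs_le_iff)
    ultimately show ?thesis
      unfolding gamma_mean_cmult gamma_mean_exp[OF A(1)] by (simp add: abs_le_iff del: power_Suc)
  qed
  have "(\<lambda>k. (K * ?r ^ Suc (nat (- j))) * (szasz_basis n k x * ?r ^ nat k)) summable_on {j..}"
    using has_sum_imp_summable[OF szasz_basis_generating_has_sum]
    by (intro summable_on_cmult_right) (auto intro: summable_on_subset_banach)
  then have "(\<lambda>k. norm (szasz_basis n k x * gamma_mean n (nat (k - j)) f)) summable_on {j..}"
  proof (rule summable_on_comparison_test)
    fix k assume "k \<in> {j..}"
    have "norm (szasz_basis n k x * gamma_mean n (nat (k - j)) f) \<le>
        szasz_basis n k x * (K * ?r ^ Suc (nat (k - j)))"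
      using szasz_basis_nonneg[OF A(3)] mean by (simp add: abs_mult mult_left_mono del: power_Suc)
    also have "\<dots> = K * (szasz_basis n k x * ?r ^ Suc (nat (k - j)))" by simp
    also have "\<dots> \<le> K * (?r ^ Suc (nat (- j)) * (szasz_basis n k x * ?r ^ nat k))"
      using K(1) A \<open>k \<in> {j..}\<close> by (intro mult_left_mono szasz_tail_exp_term_le) auto
    finally show "norm (szasz_basis n k x * gamma_mean n (nat (k - j)) f) \<le>
        (K * ?r ^ Suc (nat (- j))) * (szasz_basis n k x * ?r ^ nat k)" by (simp only: mult.assoc)
  qed simp
  then show ?thesis by (rule abs_summable_summable)
qed

lemma szasz_tail_add:
  assumes "f \<in> E_exp A" "g \<in> E_exp A" "real n > A" "A \<ge> 0" "x \<ge> 0"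
  shows "szasz_tail n j (\<lambda>t. f t + g t) x = szasz_tail n j f x + szasz_tail n j g x"
  unfolding szasz_tail_def gamma_mean_add[OF assms(1-4)] distrib_left
  using assms by (intro infsum_add szasz_tail_summable)

lemma szasz_tail_cmult: "szasz_tail n j (\<lambda>t. c * f t) x = c * szasz_tail n j f x"
  unfolding szasz_tail_def gamma_mean_cmult mult.left_commute[of _ c] by (rule infsum_cmult_right')

lemma szasz_tail_mono:
  assumes "f \<in> E_exp A" "g \<in> E_exp A" "real n > A" "A \<ge> 0" "x \<ge> 0"
    and "\<And>t. t \<ge> 0 \<Longrightarrow> f t \<le> g t"
  shows "szasz_tail n j f x \<le> szasz_tail n j g x"
  unfolding szasz_tail_def using assms
  by (intro infsum_mono mult_left_mono gamma_mean_mono szasz_tail_summable szasz_basis_nonneg) auto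

lemma szasz_tail_abs_le:
  assumes "f \<in> E_exp A" "g \<in> E_exp A" "real n > A" "A \<ge> 0" "x \<ge> 0"
    and "\<And>t. t \<ge> 0 \<Longrightarrow> \<bar>f t\<bar> \<le> g t"
  shows "\<bar>szasz_tail n j f x\<bar> \<le> szasz_tail n j g x"
proof -
  have "szasz_tail n j f x \<le> szasz_tail n j g x"
    using assms(6) by (intro szasz_tail_mono[OF assms(1-5)]) fastforce
  moreover have "szasz_tail n j (\<lambda>t. (-1) * f t) x \<le> szasz_tail n j g x"
    using assms(6) by (intro szasz_tail_mono[OF E_exp_cmult[OF assms(1)] assms(2-5)]) fastforce
  ultimately show ?thesis unfolding szasz_tail_cmult by simp
qed

text \<open>For \<open>n \<ge> 2 A\<close> the ratio \<open>n / (n - A)\<close> is at most \<open>2\<close>, and \<open>n (n / (n - A) - 1) = A n / (n - A)\<close> is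
  at most \<open>2 A\<close>; hence exponentials stay bounded in \<open>n\<close> at a fixed \<open>x\<close>.\<close>

lemma szasz_tail_exp_le:
  assumes "real n \<ge> 2 * A" "A > 0" "x \<ge> 0"
  shows "szasz_tail n j (\<lambda>t. exp (A * t)) x \<le> 2 ^ Suc (nat (- j)) * exp (2 * A * x)"
proof -
  let ?r = "real n / (real n - A)"
  have n: "real n > A" "real n \<ge> 0" using assms by linarith+
  have gen: "((\<lambda>k. ?r ^ Suc (nat (- j)) * (szasz_basis n k x * ?r ^ nat k)) has_sum
      ?r ^ Suc (nat (- j)) * exp (real n * x * (?r - 1))) UNIV"
    by (intro has_sum_cmult_right szasz_basis_generating_has_sum)
  have tail: "((\<lambda>k. szasz_basis n k x * gamma_mean n (nat (k - j)) (\<lambda>t. exp (A * t))) has_sum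
      szasz_tail n j (\<lambda>t. exp (A * t)) x) {j..}"
    unfolding szasz_tail_def using assms n
    by (intro has_sum_infsum szasz_tail_summable[OF exp_in_E_exp]) auto
  have "szasz_tail n j (\<lambda>t. exp (A * t)) x \<le> ?r ^ Suc (nat (- j)) * exp (real n * x * (?r - 1))"
  proof (rule has_sum_mono_neutral[OF tail gen])
    show "szasz_basis n k x * gamma_mean n (nat (k - j)) (\<lambda>t. exp (A * t)) \<le>
        ?r ^ Suc (nat (- j)) * (szasz_basis n k x * ?r ^ nat k)" if "k \<in> {j..} \<inter> UNIV" for k
      unfolding gamma_mean_exp[OF n(1)] using that assms n by (intro szasz_tail_exp_term_le) auto
    show "0 \<le> ?r ^ Suc (nat (- j)) * (szasz_basis n k x * ?r ^ nat k)" for k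
      using n assms by (intro mult_nonneg_nonneg szasz_basis_nonneg zero_le_power) auto
  qed simp
  also have "\<dots> \<le> 2 ^ Suc (nat (- j)) * exp (2 * A * x)"
  proof (intro mult_mono power_mono)
    show r: "?r \<le> 2" using assms n by (simp add: field_simps)
    have "real n * (?r - 1) = A * ?r" using n by (simp add: field_simps)
    also have "\<dots> \<le> A * 2" using r assms by (intro mult_left_mono) auto
    finally have "real n * (?r - 1) * x \<le> A * 2 * x" using assms(3) by (rule mult_right_mono)
    then show "exp (real n * x * (?r - 1)) \<le> exp (2 * A * x)" by (simp add: mult_ac)
  qed (use n assms in auto)
  finally show ?thesis .
qed

section \<open>Moments and the Chu--Vandermonde identity\<close>

text \<open>The differential operator \<open>\<D>\<^sub>j\<^bsup>2k\<^esup>\<close> at \<open>x\<close>, expanded by the Leibniz rule, as a linear form in the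
  values \<open>a m\<close> of the derivatives of order \<open>m\<close>. It reads only the orders \<open>k \<le> m \<le> 2 k\<close>, and on such a
  form linearity and vanishing are evident, whereas \<^const>\<open>deriv\<close> is additive only under
  differentiability hypotheses.\<close>

definition jet_op :: "int \<Rightarrow> nat \<Rightarrow> real \<Rightarrow> (nat \<Rightarrow> real) \<Rightarrow> real" where
  "jet_op j k x a =
     (\<Sum>i\<le>k. real (k choose i) * (fact i * (of_int (int k - j) gchoose i)) * x ^ (k - i) * a (2 * k - i))"

lemma jet_op_cong:
  "(\<And>m. k \<le> m \<Longrightarrow> m \<le> 2 * k \<Longrightarrow> a m = b m) \<Longrightarrow> jet_op j k x a = jet_op j k x b"
  unfolding jet_op_def by (intro sum.cong refl arg_cong2[where f = "(*)"]) auto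

lemma jet_op_add: "jet_op j k x (\<lambda>m. a m + b m) = jet_op j k x a + jet_op j k x b"
  by (simp add: jet_op_def distrib_left sum.distrib)

lemma jet_op_cmult: "jet_op j k x (\<lambda>m. c * a m) = c * jet_op j k x a"
  by (simp add: jet_op_def sum_distrib_left mult_ac)

lemma higher_pderiv_monom_fact:
  "(pderiv ^^ m) (monom (1::real) N) = (if m \<le> N then monom (fact N / fact (N - m)) (N - m) else 0)"
proof (induction m)
  case (Suc m)
  show ?case
  proof (cases "Suc m \<le> N")
    case True
    then have "N - m = Suc (N - Suc m)" by simp
    then show ?thesis using Suc True by (simp add: pderiv_monom field_simps)
  next
    case False
    then show ?thesis using Suc by (simp add: pderiv_monom monom_0)
  qed
qed simp

text \<open>The binomial coefficient that comes from the derivatives of \<open>t ^ N\<close> beyond the first \<open>k\<close> is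
  combined with the one that comes from \<open>t powi (k - j)\<close> by the Chu--Vandermonde identity.\<close>

lemma jet_op_monom:
  "jet_op j k x (\<lambda>m. poly ((pderiv ^^ m) (monom 1 N)) x) =
     (if k \<le> N then fact k * (fact N / fact (N - k)) * (of_int (int N - j) gchoose k) * x ^ (N - k) else 0)"
proof (cases "k \<le> N")
  case True
  have jet_term: "real (k choose i) * (fact i * (of_int (int k - j) gchoose i)) * x ^ (k - i) *
        poly ((pderiv ^^ (2 * k - i)) (monom 1 N)) x =
      fact k * (fact N / fact (N - k)) * x ^ (N - k) *
        ((of_int (int k - j) gchoose i) * (real (N - k) gchoose (k - i)))" if "i \<in> {..k}" for i
  proof (cases "2 * k - i \<le> N")
    case le: True
    have 1: "real (k choose i) * fact i = fact k / fact (k - i)"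
      using that by (simp add: binomial_fact)
    have 2: "real (N - k) gchoose (k - i) = fact (N - k) / (fact (k - i) * fact (N - (2 * k - i)))"
    proof -
      have "N - k - (k - i) = N - (2 * k - i)" using le that by auto
      then show ?thesis using binomial_fact[of "k - i" "N - k", where ?'a = real] le that
        unfolding binomial_gbinomial by simp
    qed
    have 3: "x ^ (k - i) * x ^ (N - (2 * k - i)) = x ^ (N - k)"
      using le that True by (simp flip: power_add)
    have "real (k choose i) * (fact i * (of_int (int k - j) gchoose i)) * x ^ (k - i) *
        poly ((pderiv ^^ (2 * k - i)) (monom 1 N)) x =
      (real (k choose i) * fact i) * (of_int (int k - j) gchoose i) *
        (x ^ (k - i) * x ^ (N - (2 * k - i))) * (fact N / fact (N - (2 * k - i)))"
      using le by (simp add: higher_pderiv_monom_fact poly_monom)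
    also have "\<dots> = fact k * (fact N / fact (N - k)) * x ^ (N - k) *
        ((of_int (int k - j) gchoose i) * (real (N - k) gchoose (k - i)))"
      unfolding 1 2 3 by simp
    finally show ?thesis .
  next
    case False
    then have "N - k < k - i" using that \<open>k \<le> N\<close> by auto
    then have "real (N - k) gchoose (k - i) = 0"
      by (metis binomial_eq_0 binomial_gbinomial of_nat_0)
    then show ?thesis using False by (simp add: higher_pderiv_monom_fact)
  qed
  have "jet_op j k x (\<lambda>m. poly ((pderiv ^^ m) (monom 1 N)) x) =
      fact k * (fact N / fact (N - k)) * x ^ (N - k) *
      (\<Sum>i\<le>k. (of_int (int k - j) gchoose i) * (real (N - k) gchoose (k - i)))"
    unfolding jet_op_def sum_distrib_left by (intro sum.cong refl jet_term)
  also have "(\<Sum>i\<le>k. (of_int (int k - j) gchoose i) * (real (N - k) gchoose (k - i))) =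
      (of_int (int k - j) + real (N - k)) gchoose k"
    using gbinomial_Vandermonde[of "of_int (int k - j) :: real" "real (N - k)" k]
    by (simp add: atMost_atLeast0)
  also have "of_int (int k - j) + real (N - k) = (of_int (int N - j) :: real)"
    using True by (simp add: of_nat_diff)
  finally show ?thesis using True by simp
next
  case False
  then have "jet_op j k x (\<lambda>m. poly ((pderiv ^^ m) (monom 1 N)) x) = jet_op j k x (\<lambda>m. 0)"
    by (intro jet_op_cong) (simp add: higher_pderiv_monom_fact)
  with False show ?thesis by (simp add: jet_op_def)
qed

lemma has_sum_finite_sum:
  fixes g :: "'i \<Rightarrow> 'a \<Rightarrow> real"
  assumes "\<And>i. i \<in> I \<Longrightarrow> (g i has_sum s i) A"
  shows "((\<lambda>k. \<Sum>i\<in>I. g i k) has_sum (\<Sum>i\<in>I. s i)) A"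
  using assms by (induction I rule: infinite_finite_induct) (auto intro: has_sum_add)

text \<open>The \<open>N\<close>-th moment of the gamma density with index \<open>k - j\<close> is a rising factorial, that is, up to
  the factor \<open>N! / n ^ N\<close>, a binomial coefficient with upper entry \<open>k - j + N\<close>. Chu--Vandermonde splits
  it into binomial coefficients of \<open>k\<close>, whose Poisson means are known, and of \<open>N - j\<close>; the latter are
  the ones in the value of \<open>\<D>\<^sub>j\<^bsup>2i\<^esup>\<close> at \<open>t ^ N\<close>.\<close>

lemma szasz_basis_rising_moment_has_sum:
  assumes "n > 0"
  shows "((\<lambda>k. szasz_basis n k x * (fact N * (of_int (k - j + int N) gchoose N) / real n ^ N)) has_sum
     (\<Sum>i\<le>N. (fact N / fact (N - i)) * (of_int (int N - j) gchoose i) * x ^ (N - i) / real n ^ i)) UNIV"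
proof -
  let ?c = "\<lambda>i. fact N / real n ^ N * (of_int (int N - j) gchoose i)"
  have "((\<lambda>k. \<Sum>i\<le>N. ?c i * (szasz_basis n k x * (of_int k gchoose (N - i)))) has_sum
      (\<Sum>i\<le>N. ?c i * ((real n * x) ^ (N - i) / fact (N - i)))) UNIV"
    by (intro has_sum_finite_sum has_sum_cmult_right szasz_basis_binomial_moment_has_sum)
  also have "(\<lambda>k. \<Sum>i\<le>N. ?c i * (szasz_basis n k x * (of_int k gchoose (N - i)))) =
     (\<lambda>k. szasz_basis n k x * (fact N * (of_int (k - j + int N) gchoose N) / real n ^ N))"
  proof
    fix k
    have "(of_int (k - j + int N) :: real) = of_int (int N - j) + of_int k" by simp
    then have "(of_int (k - j + int N) :: real) gchoose N =
       (\<Sum>i\<le>N. (of_int (int N - j) gchoose i) * (of_int k gchoose (N - i)))"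
      by (simp only: gbinomial_Vandermonde atMost_atLeast0)
    then show "(\<Sum>i\<le>N. ?c i * (szasz_basis n k x * (of_int k gchoose (N - i)))) =
       szasz_basis n k x * (fact N * (of_int (k - j + int N) gchoose N) / real n ^ N)"
      by (simp add: sum_distrib_left sum_divide_distrib mult_ac)
  qed
  also have "(\<Sum>i\<le>N. ?c i * ((real n * x) ^ (N - i) / fact (N - i))) =
     (\<Sum>i\<le>N. (fact N / fact (N - i)) * (of_int (int N - j) gchoose i) * x ^ (N - i) / real n ^ i)"
  proof (intro sum.cong refl)
    fix i assume "i \<in> {..N}"
    then have "real n ^ N = real n ^ i * real n ^ (N - i)" by (simp flip: power_add)
    then show "?c i * ((real n * x) ^ (N - i) / fact (N - i)) =
        (fact N / fact (N - i)) * (of_int (int N - j) gchoose i) * x ^ (N - i) / real n ^ i"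
      using assms by (simp add: power_mult_distrib field_simps)
  qed
  finally show ?thesis .
qed

text \<open>The identity for the sum over all \<open>k\<close> is exact, so on monomials the expansion fails only by the
  finitely many terms with \<open>0 \<le> k < j\<close>.\<close>

lemma szasz_tail_power:
  assumes "n > 0"
  shows "szasz_tail n j (\<lambda>t. t ^ N) x =
     (\<Sum>i\<le>N. (fact N / fact (N - i)) * (of_int (int N - j) gchoose i) * x ^ (N - i) / real n ^ i) -
     (\<Sum>k\<in>{0..j - 1}. szasz_basis n k x * (fact N * (of_int (k - j + int N) gchoose N) / real n ^ N))"
    (is "_ = ?S - ?s")
proof -
  let ?g = "\<lambda>k. szasz_basis n k x * (fact N * (of_int (k - j + int N) gchoose N) / real n ^ N)"
  have "(?g has_sum ?S) {min 0 j..}"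
    using szasz_basis_rising_moment_has_sum[OF assms]
    by (subst has_sum_cong_neutral[where T = UNIV and g = ?g]) (auto simp: szasz_basis_def)
  then have "(?g has_sum ?S - ?s) ({min 0 j..} - {0..j - 1})"
    by (intro has_sum_Diff) auto
  moreover have "{min 0 j..} - {0..j - 1} = {j..}" by auto
  ultimately have tail: "(?g has_sum ?S - ?s) {j..}" by simp
  have "fact N * (of_int (k - j + int N) gchoose N) / real n ^ N =
      gamma_mean n (nat (k - j)) (\<lambda>t. t ^ N)" if "k \<in> {j..}" for k
  proof -
    have "(of_int (k - j + int N) :: real) = of_nat (nat (k - j) + N)" using that by simp
    then have "(of_int (k - j + int N) :: real) gchoose N = of_nat ((nat (k - j) + N) choose N)"
      by (simp only: binomial_gbinomial)
    then show ?thesis unfolding gamma_mean_power[OF assms]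
      by (simp add: binomial_fact mult_ac)
  qed
  then have "((\<lambda>k. szasz_basis n k x * gamma_mean n (nat (k - j)) (\<lambda>t. t ^ N)) has_sum ?S - ?s) {j..}"
    by (intro iffD1[OF has_sum_cong tail]) (simp only:)
  then show ?thesis unfolding szasz_tail_def by (rule infsumI)
qed

section \<open>Expansion on polynomials\<close>

lemma szasz_basis_smallo:
  assumes "x > 0"
  shows "(\<lambda>n. szasz_basis n k x) \<in> o(\<lambda>n. 1 / real n ^ M)"
proof (rule smalloI_tendsto)
  have "filterlim (\<lambda>n. real n * x) at_top sequentially"
    using assms by (intro filterlim_at_top_mult_tendsto_pos[OF tendsto_const] filterlim_real_sequentially)
  then have "(\<lambda>n. (real n * x) ^ (nat k + M) / exp (real n * x)) \<longlonglongrightarrow> 0"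
    by (rule filterlim_compose[OF tendsto_power_div_exp_0])
  then have "(\<lambda>n. 1 / (fact (nat k) * x ^ M) * ((real n * x) ^ (nat k + M) / exp (real n * x))) \<longlonglongrightarrow> 0"
    by (rule tendsto_mult_right_zero)
  then have "(\<lambda>n. (if k < 0 then 0 else 1) *
      (1 / (fact (nat k) * x ^ M) * ((real n * x) ^ (nat k + M) / exp (real n * x)))) \<longlonglongrightarrow> 0"
    by (rule tendsto_mult_right_zero)
  also have "(\<lambda>n. (if k < 0 then 0 else 1) *
      (1 / (fact (nat k) * x ^ M) * ((real n * x) ^ (nat k + M) / exp (real n * x)))) =
      (\<lambda>n. szasz_basis n k x / (1 / real n ^ M))"
    using assms by (auto simp: szasz_basis_def fun_eq_iff power_add power_mult_distrib exp_minus field_simps)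
  finally show "(\<lambda>n. szasz_basis n k x / (1 / real n ^ M)) \<longlonglongrightarrow> 0" .
  show "\<forall>\<^sub>F n in sequentially. 1 / real n ^ M \<noteq> 0"
    using eventually_gt_at_top[of 0] by eventually_elim simp
qed

lemma inverse_power_bigo:
  assumes "q \<le> k"
  shows "(\<lambda>n. c / real n ^ k) \<in> O(\<lambda>n. 1 / real n ^ q)"
proof (rule landau_o.bigI[of "\<bar>c\<bar> + 1"])
  show "\<forall>\<^sub>F n in sequentially. norm (c / real n ^ k) \<le> (\<bar>c\<bar> + 1) * norm (1 / real n ^ q)"
    using eventually_ge_at_top[of 1]
  proof eventually_elim
    case (elim n)
    then have "real n ^ q \<le> real n ^ k" "real n ^ q > 0" using assms by (auto intro: power_increasing)
    then have "\<bar>c\<bar> / real n ^ k \<le> (\<bar>c\<bar> + 1) / real n ^ q" by (intro frac_le) auto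
    then show ?case by simp
  qed
qed simp

text \<open>The error is required to be \<open>O(n\<^bsup>-q-1\<^esup>)\<close>, not just \<open>o(n\<^bsup>-q\<^esup>)\<close>: with this form the case \<open>q - 1\<close>
  yields the size of the central moment of order \<open>2 q\<close>.\<close>

definition has_expansion :: "int \<Rightarrow> nat \<Rightarrow> real \<Rightarrow> real poly \<Rightarrow> bool" where
  "has_expansion j q x p \<longleftrightarrow>
    (\<lambda>n. szasz_tail n j (poly p) x -
       (\<Sum>k\<le>q. jet_op j k x (\<lambda>m. poly ((pderiv ^^ m) p) x) / (fact k * real n ^ k)))
     \<in> O(\<lambda>n. 1 / real n ^ Suc q)"

text \<open>The exact formula is a polynomial in \<open>1 / n\<close>; its terms beyond order \<open>q\<close> and the exponentially
  small terms with \<open>k < j\<close> form the error.\<close>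

lemma has_expansion_monom:
  assumes "x > 0"
  shows "has_expansion j q x (monom 1 N)"
proof -
  define b where "b k = (if k \<le> N then (fact N / fact (N - k)) * (of_int (int N - j) gchoose k) * x ^ (N - k)
     else 0)" for k
  have b: "jet_op j k x (\<lambda>m. poly ((pderiv ^^ m) (monom 1 N)) x) / (fact k * c) = b k / c" for k c
    by (simp add: jet_op_monom b_def)
  let ?s = "\<lambda>n. \<Sum>k\<in>{0..j - 1}. szasz_basis n k x * (fact N * (of_int (k - j + int N) gchoose N) / real n ^ N)"
  have "?s \<in> O(\<lambda>n. 1 / real n ^ Suc q)"
  proof (intro big_sum_in_bigo)
    fix k
    have "(\<lambda>n. szasz_basis n k x * (fact N * (of_int (k - j + int N) gchoose N) / real n ^ N))
       \<in> O(\<lambda>n. (1 / real n ^ Suc q) * (1 / real n ^ 0))"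
      by (intro landau_o.big.mult inverse_power_bigo landau_o.small_imp_big szasz_basis_smallo assms) simp
    then show "(\<lambda>n. szasz_basis n k x * (fact N * (of_int (k - j + int N) gchoose N) / real n ^ N))
       \<in> O(\<lambda>n. 1 / real n ^ Suc q)" by simp
  qed
  moreover have "(\<lambda>n. \<Sum>k\<in>{Suc q..q + N}. b k / real n ^ k) \<in> O(\<lambda>n. 1 / real n ^ Suc q)"
    by (intro big_sum_in_bigo inverse_power_bigo) simp
  ultimately have "(\<lambda>n. (\<Sum>k\<in>{Suc q..q + N}. b k / real n ^ k) - ?s n) \<in> O(\<lambda>n. 1 / real n ^ Suc q)"
    by (intro sum_in_bigo)
  moreover have "\<forall>\<^sub>F n in sequentially. szasz_tail n j (poly (monom 1 N)) x - (\<Sum>k\<le>q. b k / real n ^ k) =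
      (\<Sum>k\<in>{Suc q..q + N}. b k / real n ^ k) - ?s n"
    using eventually_gt_at_top[of 0]
  proof eventually_elim
    case (elim n)
    have "(\<Sum>i\<le>N. (fact N / fact (N - i)) * (of_int (int N - j) gchoose i) * x ^ (N - i) / real n ^ i) =
        (\<Sum>i\<le>q + N. b i / real n ^ i)"
      by (intro sum.mono_neutral_cong_left) (auto simp: b_def)
    also have "\<dots> = (\<Sum>i\<le>q. b i / real n ^ i) + (\<Sum>i\<in>{Suc q..q + N}. b i / real n ^ i)"
      by (subst sum.union_disjoint[symmetric]) (auto intro!: sum.cong)
    finally show ?case using szasz_tail_power[OF elim, of j N x] by (simp add: poly_monom[abs_def])
  qed
  ultimately show ?thesis
    unfolding has_expansion_def b by (subst landau_o.big.in_cong) auto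
qed

lemma has_expansion_add_smult:
  assumes "has_expansion j q x p" "has_expansion j q x r" "x \<ge> 0"
  shows "has_expansion j q x (smult c p + r)"
proof -
  let ?d = "\<lambda>p n. szasz_tail n j (poly p) x -
       (\<Sum>k\<le>q. jet_op j k x (\<lambda>m. poly ((pderiv ^^ m) p) x) / (fact k * real n ^ k))"
  have p: "?d p \<in> O(\<lambda>n. 1 / real n ^ Suc q)" and r: "?d r \<in> O(\<lambda>n. 1 / real n ^ Suc q)"
    using assms(1,2) unfolding has_expansion_def .
  have "(\<lambda>n. c * ?d p n) \<in> O(\<lambda>n. 1 / real n ^ Suc q)"
    using landau_o.big.mult[OF bigo_const[of c] p] by simp
  then have "(\<lambda>n. c * ?d p n + ?d r n) \<in> O(\<lambda>n. 1 / real n ^ Suc q)"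
    using r by (rule sum_in_bigo(1))
  moreover have "\<forall>\<^sub>F n in sequentially. ?d (smult c p + r) n = c * ?d p n + ?d r n"
    using eventually_gt_at_top[of 1]
  proof eventually_elim
    case (elim n)
    have "szasz_tail n j (poly (smult c p + r)) x = szasz_tail n j (\<lambda>t. c * poly p t + poly r t) x"
      by (simp add: poly_add[abs_def])
    also have "\<dots> = c * szasz_tail n j (poly p) x + szasz_tail n j (poly r) x"
      using elim assms(3) poly_in_E_exp by (subst szasz_tail_add[where A = 1])
        (auto simp: szasz_tail_cmult intro: E_exp_cmult)
    finally show ?case
      by (simp add: higher_pderiv_add higher_pderiv_smult jet_op_add jet_op_cmult add_divide_distrib
          sum.distrib sum_distrib_left right_diff_distrib)
  qed
  ultimately show ?thesis
    unfolding has_expansion_def by (subst landau_o.big.in_cong) auto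
qed

lemma has_expansion_poly:
  assumes "x > 0"
  shows "has_expansion j q x p"
proof -
  have zero: "has_expansion j q x 0"
    using szasz_tail_cmult[of _ j 0 "\<lambda>_. 0" x] by (simp add: has_expansion_def jet_op_def poly_0[abs_def])
  have "has_expansion j q x (\<Sum>i\<in>I. smult (coeff p i) (monom 1 i))" if "finite I" for I
    using that by induction (use assms in \<open>auto intro: zero has_expansion_add_smult has_expansion_monom\<close>)
  from this[of "{..degree p}"] show ?thesis
    by (simp add: smult_monom poly_as_sum_of_monoms)
qed

lemma higher_pderiv_shifted_power_at_center:
  "poly ((pderiv ^^ m) ([:- x, 1:] ^ N)) x = (if m = N then fact N else (0::real))"
proof (induction m arbitrary: N)
  case 0
  then show ?case by (cases N) (auto simp: poly_power)
next
  case (Suc m)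
  show ?case
  proof (cases N)
    case (Suc N')
    have "pderiv ([:- x, 1:] ^ N) = smult (real N) ([:- x, 1:] ^ N')"
      by (simp add: Suc pderiv_power_Suc pderiv_pCons del: power_Suc of_nat_Suc)
    then show ?thesis using Suc.IH[of N'] Suc
      by (simp add: funpow_Suc_right higher_pderiv_smult del: funpow.simps power_Suc)
  qed (simp add: funpow_Suc_right pderiv_1 del: funpow.simps)
qed

text \<open>The coefficient of \<open>n\<^bsup>-k\<^esup>\<close> involves derivatives of order at most \<open>2 k\<close> only, and those of
  \<open>(t - x) ^ (2 q)\<close> of order below \<open>2 q\<close> vanish at \<open>x\<close>. Hence the expansion up to order \<open>q - 1\<close> is
  zero.\<close>

lemma szasz_tail_central_moment_bigo:
  assumes "x > 0" "q > 0"
  shows "(\<lambda>n. szasz_tail n j (\<lambda>t. (t - x) ^ (2 * q)) x) \<in> O(\<lambda>n. 1 / real n ^ q)"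
proof -
  obtain q' where q: "q = Suc q'" using assms(2) by (cases q) auto
  let ?p = "[:- x, 1:] ^ (2 * q)"
  have jets: "jet_op j k x (\<lambda>m. poly ((pderiv ^^ m) ?p) x) = 0" if "k \<le> q'" for k
  proof -
    have "jet_op j k x (\<lambda>m. poly ((pderiv ^^ m) ?p) x) = jet_op j k x (\<lambda>m. 0)"
      using that q by (intro jet_op_cong) (simp add: higher_pderiv_shifted_power_at_center del: power_Suc)
    then show ?thesis by (simp add: jet_op_def)
  qed
  have "poly ?p = (\<lambda>t. (t - x) ^ (2 * q))" by (auto simp: poly_power)
  with has_expansion_poly[OF assms(1), of j q' ?p] jets q show ?thesis
    by (simp add: has_expansion_def del: power_Suc)
qed

section \<open>Pointwise Leibniz rule and Taylor formula\<close>

text \<open>The Leibniz rule when the highest derivatives exist at the single point \<open>x\<close>: \<open>u i\<close> and \<open>v i\<close> are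
  the derivatives of order \<open>i\<close>, and below the top order the formula holds on a neighbourhood, so that it
  can be differentiated once more at \<open>x\<close>.\<close>

lemma higher_deriv_mult_at:
  fixes u v :: "nat \<Rightarrow> real \<Rightarrow> real"
  assumes S: "open S" "x \<in> S"
    and u: "\<And>i y. i < N \<Longrightarrow> y \<in> S \<Longrightarrow> (u i has_real_derivative u (Suc i) y) (at y)"
    and v: "\<And>i y. i < N \<Longrightarrow> y \<in> S \<Longrightarrow> (v i has_real_derivative v (Suc i) y) (at y)"
    and ux: "\<And>i. i \<le> N \<Longrightarrow> (u i has_real_derivative u (Suc i) x) (at x)"
    and vx: "\<And>i. i \<le> N \<Longrightarrow> (v i has_real_derivative v (Suc i) x) (at x)"
  shows "(deriv ^^ Suc N) (\<lambda>t. u 0 t * v 0 t) x =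
     (\<Sum>i\<le>Suc N. real (Suc N choose i) * u i x * v (Suc N - i) x)"
proof -
  let ?L = "\<lambda>m y. \<Sum>i\<le>m. real (m choose i) * u i y * v (m - i) y"
  have step: "(?L m has_real_derivative ?L (Suc m) y) (at y)"
    if "\<And>i. i \<le> m \<Longrightarrow> (u i has_real_derivative u (Suc i) y) (at y)"
       "\<And>i. i \<le> m \<Longrightarrow> (v i has_real_derivative v (Suc i) y) (at y)" for m y
  proof -
    have "(?L m has_real_derivative
        (\<Sum>i\<le>m. real (m choose i) * (u (Suc i) y * v (m - i) y + u i y * v (Suc m - i) y))) (at y)"
      by (rule derivative_eq_intros that | simp add: Suc_diff_le algebra_simps)+
    also have "(\<Sum>i\<le>m. real (m choose i) * (u (Suc i) y * v (m - i) y + u i y * v (Suc m - i) y)) =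
        (\<Sum>i\<le>m. real (m choose i) * u (Suc i) y * v (m - i) y) +
        (\<Sum>i\<le>m. real (m choose i) * u i y * v (Suc m - i) y)"
      by (simp add: sum.distrib algebra_simps)
    also have "(\<Sum>i\<le>m. real (m choose i) * u i y * v (Suc m - i) y) =
        (\<Sum>i\<le>Suc m. real (m choose i) * u i y * v (Suc m - i) y)"
      by (simp add: binomial_eq_0)
    also have "\<dots> = u 0 y * v (Suc m) y + (\<Sum>i\<le>m. real (m choose Suc i) * u (Suc i) y * v (m - i) y)"
      by (subst sum.atMost_Suc_shift) simp
    also have "(\<Sum>i\<le>m. real (m choose i) * u (Suc i) y * v (m - i) y) +
        (u 0 y * v (Suc m) y + (\<Sum>i\<le>m. real (m choose Suc i) * u (Suc i) y * v (m - i) y)) = ?L (Suc m) y"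
      by (subst sum.atMost_Suc_shift) (simp add: sum.distrib algebra_simps)
    finally show ?thesis .
  qed
  have on_S: "(deriv ^^ m) (\<lambda>t. u 0 t * v 0 t) y = ?L m y" if "m \<le> N" "y \<in> S" for m y
    using that
  proof (induction m arbitrary: y)
    case (Suc m)
    have "\<forall>\<^sub>F z in nhds y. (deriv ^^ m) (\<lambda>t. u 0 t * v 0 t) z = ?L m z"
      using eventually_nhds_in_open[OF S(1) Suc.prems(2)] Suc by (auto elim!: eventually_mono)
    then have "deriv ((deriv ^^ m) (\<lambda>t. u 0 t * v 0 t)) y = deriv (?L m) y"
      by (rule deriv_cong_ev) simp
    also have "\<dots> = ?L (Suc m) y"
      using Suc.prems by (intro DERIV_imp_deriv step u v) auto
    finally show ?case by simp
  qed simp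
  have "\<forall>\<^sub>F z in nhds x. (deriv ^^ N) (\<lambda>t. u 0 t * v 0 t) z = ?L N z"
    using eventually_nhds_in_open[OF S] on_S by (auto elim!: eventually_mono)
  then have "deriv ((deriv ^^ N) (\<lambda>t. u 0 t * v 0 t)) x = deriv (?L N) x"
    by (rule deriv_cong_ev) simp
  also have "\<dots> = ?L (Suc N) x"
    by (intro DERIV_imp_deriv step ux vx)
  finally show ?thesis by simp
qed

lemma has_nth_deriv_atE:
  assumes "has_nth_deriv_at f r x"
  obtains S where "open S" "x \<in> S"
    "\<And>i y. i < r - 1 \<Longrightarrow> y \<in> S \<Longrightarrow> ((deriv ^^ i) f has_real_derivative (deriv ^^ Suc i) f y) (at y)"
    "((deriv ^^ (r - 1)) f has_real_derivative (deriv ^^ Suc (r - 1)) f x) (at x)"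
proof -
  obtain S where "open S" "x \<in> S" and S: "\<And>y i. y \<in> S \<Longrightarrow> i < r - 1 \<Longrightarrow> (deriv ^^ i) f differentiable (at y)"
    using assms unfolding has_nth_deriv_at_def eventually_nhds by blast
  moreover have "(g has_real_derivative deriv g y) (at y)" if "g differentiable (at y)" for g :: "real \<Rightarrow> real" and y
    using that by (simp add: DERIV_deriv_iff_real_differentiable)
  ultimately show thesis using assms that by (simp add: has_nth_deriv_at_def)
qed

lemma has_derivative_scaled_power_int:
  assumes "t \<noteq> (0::real)"
  shows "((\<lambda>t. fact i * (of_int e gchoose i) * t powi (e - int i)) has_real_derivative
     fact (Suc i) * (of_int e gchoose Suc i) * t powi (e - int (Suc i))) (at t)"
proof -
  have "((\<lambda>t. fact i * (of_int e gchoose i) * t powi (e - int i)) has_real_derivative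
     fact i * (of_int e gchoose i) * (of_int (e - int i) * t powi (e - int i - 1))) (at t)"
    using assms by (auto intro!: derivative_eq_intros)
  also have "fact i * (of_int e gchoose i) * of_int (e - int i) = fact (Suc i) * ((of_int e :: real) gchoose Suc i)"
    unfolding gbinomial_prod_rev by simp
  then have "fact i * (of_int e gchoose i) * (of_int (e - int i) * t powi (e - int i - 1)) =
     fact (Suc i) * (of_int e gchoose Suc i) * t powi (e - int (Suc i))"
    by (simp only: mult.assoc[symmetric]) (simp add: algebra_simps)
  finally show ?thesis .
qed

text \<open>Here \<open>k \<le> q\<close> leaves enough room: the outer \<open>k\<close> derivatives act on \<open>f\<^bsup>(k)\<^esup>\<close>, and they reach the order
  \<open>2 q\<close>, which is available at \<open>x\<close> alone, in the last step at most.\<close>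

lemma diff_op_eq_jet_op:
  assumes f: "has_nth_deriv_at f (2 * q) x" and x: "x > 0" and k: "k \<in> {1..q}"
  shows "diff_op j k f x = jet_op j k x (\<lambda>m. (deriv ^^ m) f x)"
proof -
  obtain S where S: "open S" "x \<in> S"
    "\<And>i y. i < 2 * q - 1 \<Longrightarrow> y \<in> S \<Longrightarrow> ((deriv ^^ i) f has_real_derivative (deriv ^^ Suc i) f y) (at y)"
    "((deriv ^^ (2 * q - 1)) f has_real_derivative (deriv ^^ Suc (2 * q - 1)) f x) (at x)"
    using has_nth_deriv_atE[OF f] by metis
  obtain N where N: "k = Suc N" using k by (cases k) auto
  let ?u = "\<lambda>i t. fact i * (of_int (int k - j) gchoose i) * t powi (int k - j - int i) :: real"
  let ?v = "\<lambda>i. (deriv ^^ (i + k)) f"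
  have f_at: "((deriv ^^ i) f has_real_derivative (deriv ^^ Suc i) f x) (at x)" if "i \<le> 2 * q - 1" for i
    using that S(2-4) by (cases "i = 2 * q - 1") auto
  have "(deriv ^^ Suc N) (\<lambda>t. ?u 0 t * ?v 0 t) x =
      (\<Sum>i\<le>Suc N. real (Suc N choose i) * ?u i x * ?v (Suc N - i) x)"
  proof (rule higher_deriv_mult_at[of "S \<inter> {0<..}" x N ?u ?v])
    fix i assume "i \<le> N"
    with k N have "i + k \<le> 2 * q - 1" by auto
    from f_at[OF this] show "(?v i has_real_derivative ?v (Suc i) x) (at x)" by simp
    show "(?u i has_real_derivative ?u (Suc i) x) (at x)"
      using x by (intro has_derivative_scaled_power_int) simp
  next
    fix i y assume i: "i < N" and y: "y \<in> S \<inter> {0<..}"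
    with k N have "i + k < 2 * q - 1" by auto
    from S(3)[OF this, of y] y show "(?v i has_real_derivative ?v (Suc i) y) (at y)" by simp
    show "(?u i has_real_derivative ?u (Suc i) y) (at y)"
      using y by (intro has_derivative_scaled_power_int) simp
  qed (use S x in auto)
  then have "diff_op j k f x = x powi j * (\<Sum>i\<le>k. real (k choose i) * ?u i x * ?v (k - i) x)"
    unfolding diff_op_def by (simp add: N)
  also have "\<dots> = jet_op j k x (\<lambda>m. (deriv ^^ m) f x)"
    unfolding jet_op_def sum_distrib_left
  proof (intro sum.cong refl)
    fix i assume "i \<in> {..k}"
    then have i: "k - i + k = 2 * k - i" "int k - int i = int (k - i)" by auto
    have "x powi j * x powi (int k - j - int i) = x powi (int k - int i)"
      using x by (simp flip: power_int_add)
    also have "\<dots> = x ^ (k - i)" unfolding i by simp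
    finally have p: "x powi j * x powi (int k - j - int i) = x ^ (k - i)" .
    have "x powi j * (real (k choose i) * ?u i x * ?v (k - i) x) =
        real (k choose i) * (fact i * (of_int (int k - j) gchoose i)) *
        (x powi j * x powi (int k - j - int i)) * (deriv ^^ (2 * k - i)) f x"
      unfolding i by (simp only: mult_ac)
    then show "x powi j * (real (k choose i) * ?u i x * ?v (k - i) x) =
        real (k choose i) * (fact i * (of_int (int k - j) gchoose i)) * x ^ (k - i) *
        (deriv ^^ (2 * k - i)) f x"
      unfolding p .
  qed
  finally show ?thesis .
qed

text \<open>Taylor's formula with the Lagrange remainder of order \<open>N\<close> contains \<open>D N\<close> at an intermediate
  point, and \<open>D N\<close> is \<open>o(\<bar>t - x\<bar>)\<close> because it vanishes at \<open>x\<close> together with its derivative.\<close>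

lemma taylor_peano_zero_jet:
  fixes D :: "nat \<Rightarrow> real \<Rightarrow> real"
  assumes S: "open S" "x \<in> S"
    and D: "\<And>i y. i < N \<Longrightarrow> y \<in> S \<Longrightarrow> (D i has_real_derivative D (Suc i) y) (at y)"
    and Dx: "(D N has_real_derivative 0) (at x)"
    and zero: "\<And>i. i \<le> N \<Longrightarrow> D i x = 0"
    and e: "e > 0"
  shows "\<exists>d>0. \<forall>t. \<bar>t - x\<bar> < d \<longrightarrow> \<bar>D 0 t\<bar> \<le> e * \<bar>t - x\<bar> ^ Suc N"
proof -
  have "((\<lambda>y. (D N y - D N x) / (y - x)) \<longlongrightarrow> 0) (at x)"
    using Dx by (simp add: has_field_derivative_iff)
  then have "\<forall>\<^sub>F y in at x. norm ((D N y - D N x) / (y - x)) < e"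
    using e by (rule order_tendstoD(2)[OF tendsto_norm_zero])
  then obtain d1 where d1: "d1 > 0" "\<And>y. y \<noteq> x \<Longrightarrow> \<bar>y - x\<bar> < d1 \<Longrightarrow> \<bar>D N y / (y - x)\<bar> < e"
    using zero[of N] by (auto simp: eventually_at dist_real_def)
  obtain d2 where d2: "d2 > 0" "ball x d2 \<subseteq> S" using S by (meson openE)
  have top: "\<bar>D N y\<bar> \<le> e * \<bar>y - x\<bar>" if "\<bar>y - x\<bar> < d1" for y
  proof (cases "y = x")
    case False
    then show ?thesis using d1(2)[OF False that] by (simp add: abs_divide field_simps)
  qed (simp add: zero)
  have "\<bar>D 0 t\<bar> \<le> e * \<bar>t - x\<bar> ^ Suc N" if t: "\<bar>t - x\<bar> < min d1 d2" for t
  proof (cases "t = x \<or> N = 0")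
    case True
    then show ?thesis using top[of t] t by (auto simp: zero)
  next
    case False
    define a b where "a = min t x" and "b = max t x"
    have ab: "y \<in> S" if "a \<le> y \<and> y \<le> b" for y
      using that t d2(2) by (auto simp: a_def b_def dist_real_def subset_iff)
    have "\<exists>s. (if t < x then t < s \<and> s < x else x < s \<and> s < t) \<and>
        D 0 t = (\<Sum>m<N. D m x / fact m * (t - x) ^ m) + D N s / fact N * (t - x) ^ N"
      by (rule Taylor[of N D "D 0" a b x t]) (use False ab D in \<open>auto simp: a_def b_def\<close>)
    then obtain s where "if t < x then t < s \<and> s < x else x < s \<and> s < t"
      and Ds: "D 0 t = D N s / fact N * (t - x) ^ N"
      by (auto simp: zero)
    then have s: "\<bar>s - x\<bar> \<le> \<bar>t - x\<bar>" by (auto split: if_splits)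
    from Ds have "\<bar>D 0 t\<bar> = \<bar>D N s\<bar> / fact N * \<bar>t - x\<bar> ^ N" by (simp add: abs_mult power_abs)
    also have "\<dots> \<le> \<bar>D N s\<bar> / 1 * \<bar>t - x\<bar> ^ N"
      by (intro mult_right_mono divide_left_mono) auto
    also have "\<dots> \<le> (e * \<bar>t - x\<bar>) * \<bar>t - x\<bar> ^ N"
    proof (intro mult_right_mono)
      have "\<bar>D N s\<bar> \<le> e * \<bar>s - x\<bar>" using s t by (intro top) auto
      also have "\<dots> \<le> e * \<bar>t - x\<bar>" using s e by (intro mult_left_mono) auto
      finally show "\<bar>D N s\<bar> / 1 \<le> e * \<bar>t - x\<bar>" by simp
    qed simp
    finally show ?thesis by simp
  qed
  then show ?thesis using d1(1) d2(1) by (intro exI[of _ "min d1 d2"]) auto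
qed

lemma DERIV_higher_pderiv:
  "(poly ((pderiv ^^ i) p) has_real_derivative poly ((pderiv ^^ Suc i) p) y) (at y)"
  by (simp add: poly_DERIV)

text \<open>Taylor's theorem with the Peano form of the remainder, under pointwise existence of the derivative
  of the highest order.\<close>

lemma taylor_poly_remainder:
  fixes x :: real
  assumes f: "has_nth_deriv_at f r x" and "r > 0"
  obtains p where "\<And>m. m \<le> r \<Longrightarrow> poly ((pderiv ^^ m) p) x = (deriv ^^ m) f x"
    and "\<And>e. e > 0 \<Longrightarrow> \<exists>d>0. \<forall>t. \<bar>t - x\<bar> < d \<longrightarrow> \<bar>f t - poly p t\<bar> \<le> e * \<bar>t - x\<bar> ^ r"
proof -
  define p where "p = (\<Sum>i\<le>r. smult ((deriv ^^ i) f x / fact i) ([:- x, 1:] ^ i))"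
  have jet: "poly ((pderiv ^^ m) p) x = (deriv ^^ m) f x" if "m \<le> r" for m
  proof -
    have "poly ((pderiv ^^ m) p) x = (\<Sum>i\<le>r. (deriv ^^ i) f x / fact i * (if m = i then fact i else 0))"
      by (simp add: p_def higher_pderiv_sum higher_pderiv_smult poly_sum higher_pderiv_shifted_power_at_center)
    also have "\<dots> = (\<Sum>i\<le>r. if i = m then (deriv ^^ i) f x else 0)" by (intro sum.cong) auto
    also have "\<dots> = (deriv ^^ m) f x" using that by (simp add: sum.delta)
    finally show ?thesis .
  qed
  obtain S where S: "open S" "x \<in> S"
    "\<And>i y. i < r - 1 \<Longrightarrow> y \<in> S \<Longrightarrow> ((deriv ^^ i) f has_real_derivative (deriv ^^ Suc i) f y) (at y)"
    "((deriv ^^ (r - 1)) f has_real_derivative (deriv ^^ Suc (r - 1)) f x) (at x)"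
    using has_nth_deriv_atE[OF f] by metis
  let ?D = "\<lambda>i t. (deriv ^^ i) f t - poly ((pderiv ^^ i) p) t"
  have "\<exists>d>0. \<forall>t. \<bar>t - x\<bar> < d \<longrightarrow> \<bar>?D 0 t\<bar> \<le> e * \<bar>t - x\<bar> ^ Suc (r - 1)" if "e > 0" for e
  proof (rule taylor_peano_zero_jet[OF S(1,2)])
    show "(?D i has_real_derivative ?D (Suc i) y) (at y)" if "i < r - 1" "y \<in> S" for i y
      by (intro DERIV_diff S(3) DERIV_higher_pderiv that)
    have "(?D (r - 1) has_real_derivative ?D (Suc (r - 1)) x) (at x)"
      by (intro DERIV_diff S(4) DERIV_higher_pderiv)
    then show "(?D (r - 1) has_real_derivative 0) (at x)"
      using jet[of r] assms(2) by simp
  qed (use jet assms(2) that in auto)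
  with jet assms(2) show thesis by (intro that[of p]) auto
qed

section \<open>Localisation and the expansion\<close>

lemma weighted_young:
  fixes a b c :: real
  assumes "c > 0" "a \<ge> 0" "b \<ge> 0"
  shows "a * b \<le> c * a\<^sup>2 + b\<^sup>2 / c"
proof -
  have "0 \<le> c * (a * b)" using assms by simp
  then have "c * (a * b) \<le> (c * a)\<^sup>2 + b\<^sup>2"
    using sum_squares_bound[of "c * a" b] by (simp add: mult.assoc)
  also have "\<dots> = c * (c * a\<^sup>2 + b\<^sup>2 / c)"
    using assms(1) by (simp add: field_simps power2_eq_square)
  finally show ?thesis using assms(1) by (rule mult_left_le_imp_le)
qed

text \<open>Away from \<open>x\<close> the function is at most a constant times \<open>\<bar>t - x\<bar> ^ (2 q + 2) exp (B t)\<close>. Young's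
  inequality separates the two factors, whose images are estimated one at a time; the weight \<open>c\<close> is
  free. With \<open>c = n ^ (q + 1)\<close> both resulting terms are \<open>O(n\<^bsup>-q-1\<^esup>)\<close> under the operator, because the
  central moment of order \<open>4 q + 4\<close> is \<open>O(n\<^bsup>-2q-2\<^esup>)\<close> and exponentials stay bounded.\<close>

lemma remainder_bound:
  fixes g :: "real \<Rightarrow> real"
  assumes near: "\<And>t. \<bar>t - x\<bar> < d \<Longrightarrow> \<bar>g t\<bar> \<le> e * (t - x) ^ (2 * q)"
    and far: "\<And>t. t \<ge> 0 \<Longrightarrow> \<bar>g t\<bar> \<le> K * exp (B * t)"
    and "d > 0" "e \<ge> 0" "K > 0" "c > 0" "t \<ge> 0"
  shows "\<bar>g t\<bar> \<le> e * (t - x) ^ (2 * q) +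
     K / d ^ (2 * q + 2) * (c * (t - x) ^ (2 * (2 * q + 2)) + exp (2 * B * t) / c)"
proof (cases "\<bar>t - x\<bar> < d")
  case True
  have "0 \<le> K / d ^ (2 * q + 2) * (c * (t - x) ^ (2 * (2 * q + 2)) + exp (2 * B * t) / c)"
    using assms(3-6) zero_le_even_power[of "2 * (2 * q + 2)" "t - x"]
    by (intro mult_nonneg_nonneg add_nonneg_nonneg divide_nonneg_nonneg) auto
  with near[OF True] show ?thesis by linarith
next
  case False
  let ?m = "2 * q + 2"
  let ?a = "\<bar>t - x\<bar> ^ ?m" and ?b = "exp (B * t)"
  have "?a * ?b \<le> c * ?a\<^sup>2 + ?b\<^sup>2 / c"
    using \<open>c > 0\<close> by (intro weighted_young) auto
  also have "?a\<^sup>2 = (t - x) ^ (2 * (2 * q + 2))"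
  proof -
    have "?a\<^sup>2 = \<bar>t - x\<bar> ^ (?m * 2)" by (rule power_mult[symmetric])
    also have "\<dots> = (t - x) ^ (?m * 2)" by (rule power_even_abs) simp
    finally show ?thesis by (simp only: mult.commute[of 2 ?m])
  qed
  also have "?b\<^sup>2 = exp (2 * B * t)" by (simp add: power2_eq_square flip: exp_add)
  finally have young: "?a * ?b \<le> c * (t - x) ^ (2 * (2 * q + 2)) + exp (2 * B * t) / c" .
  have "\<bar>g t\<bar> \<le> K * ?b" using far assms(7) .
  also have "\<dots> \<le> K * ?b * (?a / d ^ ?m)"
  proof -
    have "d ^ ?m \<le> ?a" using False assms(3) by (intro power_mono) auto
    then have "1 \<le> ?a / d ^ ?m" using assms(3) by (simp add: field_simps del: power_Suc)
    then have "K * ?b * 1 \<le> K * ?b * (?a / d ^ ?m)" using assms(5) by (intro mult_left_mono) auto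
    then show ?thesis by simp
  qed
  also have "\<dots> = K / d ^ ?m * (?a * ?b)" by simp
  also have "\<dots> \<le> K / d ^ ?m * (c * (t - x) ^ (2 * (2 * q + 2)) + exp (2 * B * t) / c)"
    using young assms(3,5) by (intro mult_left_mono) auto
  finally show ?thesis using zero_le_even_power[of "2 * q" "t - x"] assms(4)
    by (smt (verit) dvd_triv_left mult_nonneg_nonneg)
qed

text \<open>Localisation: near \<open>x\<close> the function is a small multiple of \<open>(t - x) ^ (2 q)\<close>, whose image is
  \<open>O(n\<^bsup>-q\<^esup>)\<close>, and the rest contributes \<open>O(n\<^bsup>-q-1\<^esup>)\<close>.\<close>

lemma szasz_tail_smallo:
  assumes g: "g \<in> E_exp B" "B \<ge> 1" and x: "x > 0" and q: "q > 0"
    and near: "\<And>e. e > 0 \<Longrightarrow> \<exists>d>0. \<forall>t. \<bar>t - x\<bar> < d \<longrightarrow> \<bar>g t\<bar> \<le> e * \<bar>t - x\<bar> ^ (2 * q)"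
  shows "(\<lambda>n. szasz_tail n j g x) \<in> o(\<lambda>n. 1 / real n ^ q)"
proof (rule landau_o.smallI)
  fix \<gamma> :: real assume \<gamma>: "\<gamma> > 0"
  let ?M = "\<lambda>r n. szasz_tail n j (\<lambda>t. (t - x) ^ (2 * r)) x"
  obtain C1 where C1: "C1 > 0" "\<forall>\<^sub>F n in sequentially. norm (?M q n) \<le> C1 * norm (1 / real n ^ q)"
    using szasz_tail_central_moment_bigo[OF x q, of j] by (elim landau_o.bigE)
  obtain C2 where C2: "C2 > 0"
    "\<forall>\<^sub>F n in sequentially. norm (?M (2 * q + 2) n) \<le> C2 * norm (1 / real n ^ (2 * q + 2))"
    using szasz_tail_central_moment_bigo[OF x, of "2 * q + 2" j] by (auto elim: landau_o.bigE)
  define C3 where "C3 = 2 ^ Suc (nat (- j)) * exp (2 * (2 * B) * x)"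
  define e where "e = \<gamma> / (2 * C1)"
  have e: "e > 0" using \<gamma> C1 by (simp add: e_def)
  obtain d where d: "d > 0" "\<And>t. \<bar>t - x\<bar> < d \<Longrightarrow> \<bar>g t\<bar> \<le> e * (t - x) ^ (2 * q)"
    using near[OF e] by (auto simp: power_mult)
  obtain K where K: "K > 0" "\<And>t. t \<ge> 0 \<Longrightarrow> \<bar>g t\<bar> \<le> K * exp (B * t)"
    using g(1) by (auto simp: E_exp_def)
  define L where "L = K / d ^ (2 * q + 2)"
  have L: "L > 0" using K d by (simp add: L_def)
  (* The square of exp (B t) that Young's inequality produces lives in the class with exponent 2 B. *)
  have E1: "(\<lambda>t. (t - x) ^ m) \<in> E_exp (2 * B)" for m
    using central_power_in_E_exp E_exp_mono[of 1 "2 * B"] g(2) by auto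
  have E2: "(\<lambda>t. exp (2 * B * t)) \<in> E_exp (2 * B)" by (rule exp_in_E_exp)
  have E3: "g \<in> E_exp (2 * B)" using g E_exp_mono[of B "2 * B"] by auto
  have bound: "\<forall>\<^sub>F n in sequentially. real n \<ge> 2 * L * (C2 + C3) / \<gamma> + 4 * B + 1"
    using filterlim_real_sequentially unfolding filterlim_at_top by blast
  show "\<forall>\<^sub>F n in sequentially. norm (szasz_tail n j g x) \<le> \<gamma> * norm (1 / real n ^ q)"
    using C1(2) C2(2) bound
  proof eventually_elim
    case (elim n)
    have C3: "C3 > 0" by (simp add: C3_def)
    have pos: "2 * L * (C2 + C3) / \<gamma> \<ge> 0" using L C2 C3 \<gamma> by simp
    have n: "real n > 2 * B" "2 * B \<ge> 0" "x \<ge> 0" "real n \<ge> 2 * (2 * B)" "n > 0"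
      using elim(3) pos g(2) x by linarith+
    let ?c = "real n ^ Suc q"
    have "\<bar>szasz_tail n j g x\<bar> \<le> szasz_tail n j
        (\<lambda>t. e * (t - x) ^ (2 * q) + (L * ?c * (t - x) ^ (2 * (2 * q + 2)) + L / ?c * exp (2 * B * t))) x"
    proof (rule szasz_tail_abs_le[OF E3 _ n(1-3)])
      show "(\<lambda>t. e * (t - x) ^ (2 * q) +
          (L * ?c * (t - x) ^ (2 * (2 * q + 2)) + L / ?c * exp (2 * B * t))) \<in> E_exp (2 * B)"
        by (intro E_exp_add E_exp_cmult E1 E2)
      fix t :: real assume t: "t \<ge> 0"
      show "\<bar>g t\<bar> \<le> e * (t - x) ^ (2 * q) +
          (L * ?c * (t - x) ^ (2 * (2 * q + 2)) + L / ?c * exp (2 * B * t))"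
        using remainder_bound[OF d(2) K(2) d(1) less_imp_le[OF e] K(1) _ t, of ?c, folded L_def] n(5)
        by (simp add: distrib_left mult.assoc del: power_Suc)
    qed
    also have "\<dots> = e * ?M q n + (L * ?c * ?M (2 * q + 2) n + L / ?c * szasz_tail n j (\<lambda>t. exp (2 * B * t)) x)"
      by (subst szasz_tail_add[OF _ _ n(1-3)] szasz_tail_cmult;
          (intro E_exp_add E_exp_cmult E1 E2)?)+ simp
    also have "\<dots> \<le> e * (C1 / real n ^ q) + (L * ?c * (C2 / real n ^ (2 * q + 2)) + L / ?c * C3)"
      using elim(1,2) n L e g(2) unfolding C3_def
      by (intro add_mono mult_left_mono szasz_tail_exp_le) (auto simp: abs_le_iff)
    also have "\<dots> = (\<gamma> / 2 + L * (C2 + C3) / real n) / real n ^ q"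
    proof -
      have "real n ^ (2 * q + 2) = ?c * ?c" by (simp add: power_add mult_2)
      then show ?thesis using C1(1) n(5) by (simp add: e_def field_simps)
    qed
    also have "\<dots> \<le> \<gamma> / real n ^ q"
    proof (intro divide_right_mono)
      have "2 * L * (C2 + C3) / \<gamma> \<le> real n" using elim(3) n by linarith
      then have "L * (C2 + C3) / real n \<le> \<gamma> / 2" using n(5) \<gamma> by (simp add: field_simps)
      then show "\<gamma> / 2 + L * (C2 + C3) / real n \<le> \<gamma>" by linarith
    qed simp
    finally show ?case by simp
  qed
qed

theorem theorem21:
  fixes j :: int and x :: real and q :: nat and f :: "real \<Rightarrow> real"
  assumes "x > 0"
    and "q \<ge> 1"
    and "f \<in> E_space"
    and "has_nth_deriv_at f (2 * q) x"
  shows "(\<lambda>n::nat. szasz_durrmeyer n j f x -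
            (f x + (\<Sum>k=1..q. 1 / (fact k * real n ^ k) * diff_op j k f x)))
         \<in> o(\<lambda>n. 1 / real n ^ q)"
proof -
  obtain A where A: "A \<ge> 0" "f \<in> E_exp A" using assms(3) by (auto simp: E_space_def)
  (* An exponent of at least 1 makes room for polynomials. *)
  define B where "B = A + 1"
  have "f \<in> E_exp B" using A E_exp_mono[of A B] by (auto simp: B_def)
  obtain p where jet: "\<And>m. m \<le> 2 * q \<Longrightarrow> poly ((pderiv ^^ m) p) x = (deriv ^^ m) f x"
    and near: "\<And>e. e > 0 \<Longrightarrow> \<exists>d>0. \<forall>t. \<bar>t - x\<bar> < d \<longrightarrow> \<bar>f t - poly p t\<bar> \<le> e * \<bar>t - x\<bar> ^ (2 * q)"
    using taylor_poly_remainder[OF assms(4)] assms(2) by auto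
  have p: "poly p \<in> E_exp B" using poly_in_E_exp E_exp_mono[of 1 B] A by (auto simp: B_def)
  define g where "g t = f t - poly p t" for t
  have g: "g \<in> E_exp B"
    using E_exp_add[OF \<open>f \<in> E_exp B\<close> E_exp_cmult[OF p, of "-1"]] by (simp add: g_def[abs_def])
  let ?J = "\<lambda>n. \<Sum>k\<le>q. jet_op j k x (\<lambda>m. poly ((pderiv ^^ m) p) x) / (fact k * real n ^ k)"
  have g_small: "(\<lambda>n. szasz_tail n j g x) \<in> o(\<lambda>n. 1 / real n ^ q)"
    using g A(1) assms near by (intro szasz_tail_smallo) (auto simp: g_def B_def)
  have p_small: "(\<lambda>n. szasz_tail n j (poly p) x - ?J n) \<in> o(\<lambda>n. 1 / real n ^ q)"
  proof (rule landau_o.big_small_trans)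
    show "(\<lambda>n. szasz_tail n j (poly p) x - ?J n) \<in> O(\<lambda>n. 1 / real n ^ Suc q)"
      using has_expansion_poly[OF assms(1)] unfolding has_expansion_def .
    show "(\<lambda>n. 1 / real n ^ Suc q) \<in> o(\<lambda>n. 1 / real n ^ q)"
    proof (rule smalloI_tendsto)
      have "(\<lambda>n. (1 / real n ^ Suc q) / (1 / real n ^ q)) = (\<lambda>n. inverse (real n))"
        by (auto simp: fun_eq_iff field_simps)
      then show "(\<lambda>n. (1 / real n ^ Suc q) / (1 / real n ^ q)) \<longlonglongrightarrow> 0"
        using lim_inverse_n by simp
      show "\<forall>\<^sub>F n in sequentially. 1 / real n ^ q \<noteq> 0"
        using eventually_gt_at_top[of 0] by eventually_elim simp
    qed
  qed
  have "(\<lambda>n. f 0 * (\<Sum>k\<in>{0..j - 1}. szasz_basis n k x)) \<in> o(\<lambda>n. 1 / real n ^ q)"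
  proof -
    have "(\<lambda>n. \<Sum>k\<in>{0..j - 1}. szasz_basis n k x) \<in> o(\<lambda>n. 1 / real n ^ q)"
      by (intro big_sum_in_smallo szasz_basis_smallo assms)
    from landau_o.big_small_mult[OF bigo_const this, of "f 0"] show ?thesis by simp
  qed
  from sum_in_smallo(1)[OF this sum_in_smallo(1)[OF p_small g_small]]
  have "(\<lambda>n. f 0 * (\<Sum>k\<in>{0..j - 1}. szasz_basis n k x) +
      ((szasz_tail n j (poly p) x - ?J n) + szasz_tail n j g x)) \<in> o(\<lambda>n. 1 / real n ^ q)" .
  moreover have "\<forall>\<^sub>F n in sequentially. szasz_durrmeyer n j f x -
      (f x + (\<Sum>k=1..q. 1 / (fact k * real n ^ k) * diff_op j k f x)) =
      f 0 * (\<Sum>k\<in>{0..j - 1}. szasz_basis n k x) +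
      ((szasz_tail n j (poly p) x - ?J n) + szasz_tail n j g x)"
    using eventually_gt_at_top[of "nat \<lceil>B\<rceil>"]
  proof eventually_elim
    case (elim n)
    then have n: "real n > B" "n > 0" by linarith+
    have "szasz_tail n j f x = szasz_tail n j (\<lambda>t. poly p t + g t) x" by (simp add: g_def)
    also have "\<dots> = szasz_tail n j (poly p) x + szasz_tail n j g x"
      using p g n(1) A assms(1) by (intro szasz_tail_add[where A = B]) (auto simp: B_def)
    finally have tail: "szasz_tail n j f x = szasz_tail n j (poly p) x + szasz_tail n j g x" .
    have jet_eq: "jet_op j k x (\<lambda>m. poly ((pderiv ^^ m) p) x) = jet_op j k x (\<lambda>m. (deriv ^^ m) f x)"
      if "k \<le> q" for k using that by (intro jet_op_cong jet) simp
    have "?J n = jet_op j 0 x (\<lambda>m. (deriv ^^ m) f x) +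
        (\<Sum>k=1..q. jet_op j k x (\<lambda>m. (deriv ^^ m) f x) / (fact k * real n ^ k))"
      by (simp add: jet_eq atMost_atLeast0 sum.atLeast_Suc_atMost)
    also have "jet_op j 0 x (\<lambda>m. (deriv ^^ m) f x) = f x" by (simp add: jet_op_def)
    also have "(\<Sum>k=1..q. jet_op j k x (\<lambda>m. (deriv ^^ m) f x) / (fact k * real n ^ k)) =
        (\<Sum>k=1..q. 1 / (fact k * real n ^ k) * diff_op j k f x)"
      by (intro sum.cong) (simp_all add: diff_op_eq_jet_op[OF assms(4,1)])
    finally show ?case
      unfolding szasz_durrmeyer_eq_tail[OF n(2)] tail by simp
  qed
  ultimately show ?thesis by (subst landau_o.small.in_cong) auto
qed

end
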